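(* Assume (H0), (H1), (H2), (H3), (H4) and (H5) (all stated in full in the context). Let $(\bar v^{ij})_{(i,j)\in\Gamma^1\times\Gamma^2}$ be the unique continuous viscosity solution in the class $\Pi_g$ of the min-max system: for all $(i,j)\in\Gamma^1\times\Gamma^2$ and $(t,x)\in[0,T]\times\mathbb{R}^k$, $$\min\Big\{\bar v^{ij}-L^{ij}(\vec{\bar v})\,;\,\max\big\{\bar v^{ij}-U^{ij}(\vec{\bar v})\,;\,-\partial_t\bar v^{ij}-\mathcal{L}^X\bar v^{ij}-f^{ij}(t,x,(\bar v^{kl}(t,x))_{(k,l)\in\Gamma^1\times\Gamma^2},\sigma(t,x)^\top D_x\bar v^{ij}(t,x))\big\}\Big\}(t,x)=0,\qquad \bar v^{ij}(T,x)=h^{ij}(x),$$ and let $(\underline v^{ij})_{(i,j)\in\Gamma^1\times\Gamma^2}$ be the unique continuous viscosity solution in the class $\Pi_g$ of the max-min system: for all $(i,j)\in\Gamma^1\times\Gamma^2$ and $(t,x)\in[0,T]\times\mathbb{R}^k$, $$\max\Big\{\underline v^{ij}-U^{ij}(\vec{\underline v})\,;\,\min\big\{\underline v^{ij}-L^{ij}(\vec{\underline v})\,;\,-\partial_t\underline v^{ij}-\mathcal{L}^X\underline v^{ij}-f^{ij}(t,x,(\underline v^{kl}(t,x))_{(k,l)\in\Gamma^1\times\Gamma^2},\sigma(t,x)^\top D_x\underline v^{ij}(t,x))\big\}\Big\}(t,x)=0,\qquad \underline v^{ij}(T,x)=h^{ij}(x).$$ Then for every $(i,j)\in\Gamma^1\times\Gamma^2$,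 $$\bar v^{ij}=\underline v^{ij}\quad\text{on }[0,T]\times\mathbb{R}^k.$$
   Context: Setting. $T>0$ is fixed, $k,d\ge 1$ are integers, $\Gamma^1,\Gamma^2$ are finite sets (switching modes), $\Gamma=\Gamma^1\times\Gamma^2$, $\Lambda=|\Gamma|$. The data are functions $b:[0,T]\times\mathbb{R}^k\to\mathbb{R}^k$, $\sigma:[0,T]\times\mathbb{R}^k\to\mathbb{R}^{k\times d}$, $f^{ij}:[0,T]\times\mathbb{R}^{k}\times\mathbb{R}^{\Lambda}\times\mathbb{R}^d\to\mathbb{R}$, $h^{ij}:\mathbb{R}^k\to\mathbb{R}$ for $(i,j)\in\Gamma$, $\underline g_{ii'}:[0,T]\times\mathbb{R}^k\to\mathbb{R}$ for $i,i'\in\Gamma^1$, and $\bar g_{jl}:[0,T]\times\mathbb{R}^k\to\mathbb{R}$ for $j,l\in\Gamma^2$, with the convention $\underline g_{ii}=\bar g_{jj}=0$. $\Pi_g$ is the class of functions $\Phi$ of polynomial growth: $|\Phi(t,x)|\le C(1+|x|^\gamma)$ for some constants $C,\gamma\ge0$ and all $(t,x)$. $\mathcal{C}^{1,2}$ is the set of real functions on $[0,T]\times\mathbb{R}^k$ once differentiable in $t$ and twice in $x$ with continuous derivatives. For $\vec v=(v^{kl})_{(k,l)\in\Gamma}$, $$L^{ij}(\vec v)(t,x)=\max_{i'\in\Gamma^1,\,i'\ne i}\{v^{i'j}(t,x)-\underline g_{ii'}(t,x)\},\qquad U^{ij}(\vec v)(t,x)=\min_{l\in\Gamma^2,\,l\ne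 j}\{v^{il}(t,x)+\bar g_{jl}(t,x)\},$$ and $\mathcal{L}^X\phi(t,x)=\frac12\mathrm{Tr}[\sigma\sigma^\top(t,x)D^2_{xx}\phi(t,x)]+b(t,x)^\top D_x\phi(t,x)$. Assumptions. (H0) $b,\sigma$ are jointly continuous in $(t,x)$ and Lipschitz in $x$ uniformly in $t$. (H1) Each $f^{ij}$ is: (i) continuous in $(t,x)$ uniformly w.r.t. $(\vec y,z)$ (i.e. for every $(t,x)$ and $\varepsilon>0$ there is $\eta>0$ such that $|(t',x')-(t,x)|<\eta$ implies $|f^{ij}(t',x',\vec y,z)-f^{ij}(t,x,\vec y,z)|<\varepsilon$ for all $(\vec y,z)$), and $(t,x)\mapsto f^{ij}(t,x,0,0)$ is of polynomial growth; (ii) Lipschitz in $(\vec y,z)$ uniformly in $(t,x)$. (H2) For every $(i,j)\in\Gamma$ and $(k,l)\ne(i,j)$, $y^{kl}\mapsto f^{ij}(t,x,\vec y,z)$ is non-decreasing, the other variables being fixed. (H3) Each $h^{ij}$ is continuous, in $\Pi_g$, and for all $(i,j)\in\Gamma$, $x\in\mathbb{R}^k$: $\max_{i'\ne i}(h^{i'j}(x)-\underline g_{ii'}(T,x))\le h^{ij}(x)\le\min_{l\ne j}(h^{il}(x)+\bar g_{jl}(T,x))$. (H4) (non free loop property) The functions $\underline g_{ii'}$ and $\bar g_{jl}$ are non-negative, jointly continuous, in $\Pi_g$, and for every loop in $\Gamma$, i.e. every sequence $(i_1,j_1),\dots,(i_N,j_N)$ in $\Gamma$ with $N\ge3$, $(i_N,j_N)=(i_1,j_1)$,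 $\mathrm{card}\{(i_1,j_1),\dots,(i_N,j_N)\}=N-1$ and, for each $q=1,\dots,N-1$, either $i_{q+1}=i_q$ or $j_{q+1}=j_q$, one has for all $(t,x)\in[0,T]\times\mathbb{R}^k$: $\sum_{q=1}^{N-1}\varphi_{i_qj_q}(t,x)\ne0$, where $\varphi_{i_qj_q}(t,x)=-\underline g_{i_qi_{q+1}}(t,x)\mathbf 1_{i_q\ne i_{q+1}}+\bar g_{j_qj_{q+1}}(t,x)\mathbf 1_{j_q\ne j_{q+1}}$. (H5) (i) For all $j,l\in\Gamma^2$, $\bar g_{jl}\in\mathcal{C}^{1,2}$, and $D_x\bar g_{jl}$, $D^2_{xx}\bar g_{jl}$ belong to $\Pi_g$; moreover for all pairwise distinct $j_1,j_2,j_3\in\Gamma^2$ and all $(s,x)\in[0,T]\times\mathbb{R}^k$, $\bar g_{j_1j_3}(s,x)<\bar g_{j_1j_2}(s,x)+\bar g_{j_2j_3}(s,x)$. (ii) There are constants $C,p$ such that for every $(i,j)\in\Gamma$, $|f^{ij}(s,x,\vec y,z)|\le C(1+|x|^p)$ for all $(s,x,\vec y,z)$. Viscosity solutions. A family $\vec v=(v^{ij})_{(i,j)\in\Gamma}$ of continuous functions is a viscosity subsolution (resp. supersolution) of the min-max system if for every $(i,j)$, $v^{ij}(T,x)\le h^{ij}(x)$ (resp. $\ge$) for all $x$, and for every $(t_0,x_0)\in[0,T)\times\mathbb{R}^k$ and $\phi\in\mathcal{C}^{1,2}$ such that $\phi(t_0,x_0)=v^{ij}(t_0,x_0)$ and $\phi-v^{ij}$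 has a local minimum (resp. maximum) at $(t_0,x_0)$, $$\min\{(v^{ij}-L^{ij}(\vec v))(t_0,x_0);\max\{(v^{ij}-U^{ij}(\vec v))(t_0,x_0);-\partial_t\phi(t_0,x_0)-\mathcal{L}^X\phi(t_0,x_0)-f^{ij}(t_0,x_0,(v^{kl}(t_0,x_0))_{(k,l)\in\Gamma},\sigma(t_0,x_0)^\top D_x\phi(t_0,x_0))\}\}\le0$$ (resp. $\ge0$); it is a viscosity solution if it is both. The notion for the max-min system is the same with the corresponding expression $\max\{v^{ij}-U^{ij}(\vec v);\min\{v^{ij}-L^{ij}(\vec v);\cdots\}\}$. Known fact (earlier work): under (H0)-(H4), each of the min-max and max-min systems has a unique continuous viscosity solution in the class $\Pi_g$. *)

theory Defs
  imports "HOL-Analysis.Analysis"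
begin

text \<open>
  The switching modes \<open>\<Gamma>\<^sup>1\<close> and \<open>\<Gamma>\<^sup>2\<close> are finite types \<open>'i\<close> and \<open>'j\<close>, the spaces \<open>\<real>\<^sup>k\<close>, \<open>\<real>\<^sup>d\<close> and
  \<open>\<real>\<^sup>\<Lambda>\<close> are \<open>real ^ 'k\<close>, \<open>real ^ 'd\<close> and \<open>real ^ ('i \<times> 'j)\<close>, and a \<open>k \<times> d\<close> matrix has type
  \<open>real ^ 'd ^ 'k\<close>. A function on \<open>[0,T] \<times> \<real>\<^sup>k\<close> is a curried total function of which only the values
  at times in \<open>{0..T}\<close> matter.
\<close>

type_synonym ('i, 'j, 'k) family = "'i \<Rightarrow> 'j \<Rightarrow> real \<Rightarrow> real ^ 'k \<Rightarrow> real"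

type_synonym ('i, 'j, 'k, 'd) driver =
  "'i \<Rightarrow> 'j \<Rightarrow> real \<Rightarrow> real ^ 'k \<Rightarrow> real ^ ('i \<times> 'j) \<Rightarrow> real ^ 'd \<Rightarrow> real"

subsection \<open>Function classes\<close>

definition jointly_continuous ::
  "real \<Rightarrow> (real \<Rightarrow> real ^ 'k::finite \<Rightarrow> 'a::topological_space) \<Rightarrow> bool" where
  "jointly_continuous T \<Phi> \<longleftrightarrow> continuous_on ({0..T} \<times> UNIV) (\<lambda>(t, x). \<Phi> t x)"

text \<open>The class \<open>\<Pi>\<^sub>g\<close>. Since \<open>0 powr 0 = 0\<close>, the bound for \<open>\<gamma> = 0\<close> reads \<open>C\<close> instead of \<open>2 C\<close> at the
  origin; enlarging \<open>C\<close> makes up for this, so the class is not affected.\<close>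

definition poly_growth ::
  "real \<Rightarrow> (real \<Rightarrow> real ^ 'k::finite \<Rightarrow> 'a::real_normed_vector) \<Rightarrow> bool" where
  "poly_growth T \<Phi> \<longleftrightarrow>
    (\<exists>C \<gamma>. 0 \<le> C \<and> 0 \<le> \<gamma> \<and> (\<forall>t\<in>{0..T}. \<forall>x. norm (\<Phi> t x) \<le> C * (1 + norm x powr \<gamma>)))"

text \<open>\<open>C12 T \<phi> \<phi>\<^sub>t D\<phi> D2\<phi>\<close>: the function \<open>\<phi>\<close> is of class \<open>C\<^sup>1\<^sup>,\<^sup>2\<close> on \<open>[0,T] \<times> \<real>\<^sup>k\<close>, with time derivative
  \<open>\<phi>\<^sub>t\<close> (one-sided at the end points), space gradient \<open>D\<phi>\<close> and space Hessian \<open>D2\<phi>\<close>. For \<open>T > 0\<close>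
  these are uniquely determined by \<open>\<phi>\<close>.\<close>

definition C12 ::
  "real \<Rightarrow> (real \<Rightarrow> real ^ 'k::finite \<Rightarrow> real) \<Rightarrow> (real \<Rightarrow> real ^ 'k \<Rightarrow> real) \<Rightarrow>
   (real \<Rightarrow> real ^ 'k \<Rightarrow> real ^ 'k) \<Rightarrow> (real \<Rightarrow> real ^ 'k \<Rightarrow> real ^ 'k ^ 'k) \<Rightarrow> bool" where
  "C12 T \<phi> \<phi>\<^sub>t D\<phi> D2\<phi> \<longleftrightarrow>
    (\<forall>t\<in>{0..T}. \<forall>x.
      ((\<lambda>s. \<phi> s x) has_real_derivative \<phi>\<^sub>t t x) (at t within {0..T}) \<and>
      (GDERIV (\<phi> t) x :> D\<phi> t x) \<and>
      (D\<phi> t has_derivative (\<lambda>w. D2\<phi> t x *v w)) (at x)) \<and>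
    jointly_continuous T \<phi>\<^sub>t \<and> jointly_continuous T D\<phi> \<and> jointly_continuous T D2\<phi>"

subsection \<open>The two systems\<close>

text \<open>Obstacles. They are extended real valued so that the maximum (minimum) over an empty set of
  alternative modes is \<open>-\<infinity>\<close> (\<open>\<infinity>\<close>), i.e. with a single mode there is no obstacle; otherwise
  \<open>SUP\<close> and \<open>INF\<close> range over finite nonempty sets of reals.\<close>

definition lower_obstacle ::
  "('i::finite \<Rightarrow> 'i \<Rightarrow> real \<Rightarrow> real ^ 'k::finite \<Rightarrow> real) \<Rightarrow> ('i, 'j::finite, 'k) family \<Rightarrow>
   'i \<Rightarrow> 'j \<Rightarrow> real \<Rightarrow> real ^ 'k \<Rightarrow> ereal" where
  "lower_obstacle gl v i j t x = (SUP i'\<in>{i'. i' \<noteq> i}. ereal (v i' j t x - gl i i' t x))"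

definition upper_obstacle ::
  "('j::finite \<Rightarrow> 'j \<Rightarrow> real \<Rightarrow> real ^ 'k::finite \<Rightarrow> real) \<Rightarrow> ('i::finite, 'j, 'k) family \<Rightarrow>
   'i \<Rightarrow> 'j \<Rightarrow> real \<Rightarrow> real ^ 'k \<Rightarrow> ereal" where
  "upper_obstacle gu v i j t x = (INF l\<in>{l. l \<noteq> j}. ereal (v i l t x + gu j l t x))"

text \<open>In the following operators \<open>a\<close>, \<open>p\<close> and \<open>X\<close> stand for \<open>\<partial>\<^sub>t\<phi>(t,x)\<close>, \<open>D\<^sub>x\<phi>(t,x)\<close> and
  \<open>D\<^sup>2\<^sub>x\<^sub>x\<phi>(t,x)\<close>.\<close>

definition diffusion_generator ::
  "(real \<Rightarrow> real ^ 'k::finite \<Rightarrow> real ^ 'k) \<Rightarrow> (real \<Rightarrow> real ^ 'k \<Rightarrow> real ^ 'd::finite ^ 'k) \<Rightarrow>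
   real \<Rightarrow> real ^ 'k \<Rightarrow> real ^ 'k \<Rightarrow> real ^ 'k ^ 'k \<Rightarrow> real" where
  "diffusion_generator b \<sigma> t x p X =
    1 / 2 * trace (\<sigma> t x ** transpose (\<sigma> t x) ** X) + b t x \<bullet> p"

definition pde_operator ::
  "(real \<Rightarrow> real ^ 'k::finite \<Rightarrow> real ^ 'k) \<Rightarrow> (real \<Rightarrow> real ^ 'k \<Rightarrow> real ^ 'd::finite ^ 'k) \<Rightarrow>
   ('i::finite, 'j::finite, 'k, 'd) driver \<Rightarrow> ('i, 'j, 'k) family \<Rightarrow>
   'i \<Rightarrow> 'j \<Rightarrow> real \<Rightarrow> real ^ 'k \<Rightarrow> real \<Rightarrow> real ^ 'k \<Rightarrow> real ^ 'k ^ 'k \<Rightarrow> real" where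
  "pde_operator b \<sigma> f v i j t x a p X =
    - a - diffusion_generator b \<sigma> t x p X
        - f i j t x (\<chi> q. v (fst q) (snd q) t x) (transpose (\<sigma> t x) *v p)"

type_synonym ('i, 'j, 'k) system =
  "('i, 'j, 'k) family \<Rightarrow> 'i \<Rightarrow> 'j \<Rightarrow> real \<Rightarrow> real ^ 'k \<Rightarrow>
   real \<Rightarrow> real ^ 'k \<Rightarrow> real ^ 'k ^ 'k \<Rightarrow> ereal"

definition min_max_system ::
  "(real \<Rightarrow> real ^ 'k::finite \<Rightarrow> real ^ 'k) \<Rightarrow> (real \<Rightarrow> real ^ 'k \<Rightarrow> real ^ 'd::finite ^ 'k) \<Rightarrow>
   ('i::finite, 'j::finite, 'k, 'd) driver \<Rightarrow>
   ('i \<Rightarrow> 'i \<Rightarrow> real \<Rightarrow> real ^ 'k \<Rightarrow> real) \<Rightarrow> ('j \<Rightarrow> 'j \<Rightarrow> real \<Rightarrow> real ^ 'k \<Rightarrow> real) \<Rightarrow>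
   ('i, 'j, 'k) system" where
  "min_max_system b \<sigma> f gl gu v i j t x a p X =
    min (ereal (v i j t x) - lower_obstacle gl v i j t x)
      (max (ereal (v i j t x) - upper_obstacle gu v i j t x)
        (ereal (pde_operator b \<sigma> f v i j t x a p X)))"

definition max_min_system ::
  "(real \<Rightarrow> real ^ 'k::finite \<Rightarrow> real ^ 'k) \<Rightarrow> (real \<Rightarrow> real ^ 'k \<Rightarrow> real ^ 'd::finite ^ 'k) \<Rightarrow>
   ('i::finite, 'j::finite, 'k, 'd) driver \<Rightarrow>
   ('i \<Rightarrow> 'i \<Rightarrow> real \<Rightarrow> real ^ 'k \<Rightarrow> real) \<Rightarrow> ('j \<Rightarrow> 'j \<Rightarrow> real \<Rightarrow> real ^ 'k \<Rightarrow> real) \<Rightarrow>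
   ('i, 'j, 'k) system" where
  "max_min_system b \<sigma> f gl gu v i j t x a p X =
    max (ereal (v i j t x) - upper_obstacle gu v i j t x)
      (min (ereal (v i j t x) - lower_obstacle gl v i j t x)
        (ereal (pde_operator b \<sigma> f v i j t x a p X)))"

subsection \<open>Viscosity solutions\<close>

definition viscosity_subsolution ::
  "real \<Rightarrow> ('i::finite \<Rightarrow> 'j::finite \<Rightarrow> real ^ 'k::finite \<Rightarrow> real) \<Rightarrow> ('i, 'j, 'k) system \<Rightarrow>
   ('i, 'j, 'k) family \<Rightarrow> bool" where
  "viscosity_subsolution T h F v \<longleftrightarrow>
    (\<forall>i j. jointly_continuous T (v i j)) \<and>
    (\<forall>i j. (\<forall>x. v i j T x \<le> h i j x) \<and>
      (\<forall>t\<^sub>0\<in>{0..<T}. \<forall>x\<^sub>0 \<phi> \<phi>\<^sub>t D\<phi> D2\<phi>.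
        C12 T \<phi> \<phi>\<^sub>t D\<phi> D2\<phi> \<and> \<phi> t\<^sub>0 x\<^sub>0 = v i j t\<^sub>0 x\<^sub>0 \<and>
        (\<forall>\<^sub>F (t, x) in at (t\<^sub>0, x\<^sub>0) within {0..T} \<times> UNIV.
          \<phi> t\<^sub>0 x\<^sub>0 - v i j t\<^sub>0 x\<^sub>0 \<le> \<phi> t x - v i j t x) \<longrightarrow>
        F v i j t\<^sub>0 x\<^sub>0 (\<phi>\<^sub>t t\<^sub>0 x\<^sub>0) (D\<phi> t\<^sub>0 x\<^sub>0) (D2\<phi> t\<^sub>0 x\<^sub>0) \<le> 0))"

definition viscosity_supersolution ::
  "real \<Rightarrow> ('i::finite \<Rightarrow> 'j::finite \<Rightarrow> real ^ 'k::finite \<Rightarrow> real) \<Rightarrow> ('i, 'j, 'k) system \<Rightarrow>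
   ('i, 'j, 'k) family \<Rightarrow> bool" where
  "viscosity_supersolution T h F v \<longleftrightarrow>
    (\<forall>i j. jointly_continuous T (v i j)) \<and>
    (\<forall>i j. (\<forall>x. v i j T x \<ge> h i j x) \<and>
      (\<forall>t\<^sub>0\<in>{0..<T}. \<forall>x\<^sub>0 \<phi> \<phi>\<^sub>t D\<phi> D2\<phi>.
        C12 T \<phi> \<phi>\<^sub>t D\<phi> D2\<phi> \<and> \<phi> t\<^sub>0 x\<^sub>0 = v i j t\<^sub>0 x\<^sub>0 \<and>
        (\<forall>\<^sub>F (t, x) in at (t\<^sub>0, x\<^sub>0) within {0..T} \<times> UNIV.
          \<phi> t\<^sub>0 x\<^sub>0 - v i j t\<^sub>0 x\<^sub>0 \<ge> \<phi> t x - v i j t x) \<longrightarrow>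
        F v i j t\<^sub>0 x\<^sub>0 (\<phi>\<^sub>t t\<^sub>0 x\<^sub>0) (D\<phi> t\<^sub>0 x\<^sub>0) (D2\<phi> t\<^sub>0 x\<^sub>0) \<ge> 0))"

definition viscosity_solution ::
  "real \<Rightarrow> ('i::finite \<Rightarrow> 'j::finite \<Rightarrow> real ^ 'k::finite \<Rightarrow> real) \<Rightarrow> ('i, 'j, 'k) system \<Rightarrow>
   ('i, 'j, 'k) family \<Rightarrow> bool" where
  "viscosity_solution T h F v \<longleftrightarrow> viscosity_subsolution T h F v \<and> viscosity_supersolution T h F v"

text \<open>\<open>v\<close> is the unique continuous viscosity solution in \<open>\<Pi>\<^sub>g\<close>; as everywhere, functions are
  identified when they agree on \<open>[0,T] \<times> \<real>\<^sup>k\<close>.\<close>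

definition unique_viscosity_solution ::
  "real \<Rightarrow> ('i::finite \<Rightarrow> 'j::finite \<Rightarrow> real ^ 'k::finite \<Rightarrow> real) \<Rightarrow> ('i, 'j, 'k) system \<Rightarrow>
   ('i, 'j, 'k) family \<Rightarrow> bool" where
  "unique_viscosity_solution T h F v \<longleftrightarrow>
    viscosity_solution T h F v \<and> (\<forall>i j. poly_growth T (v i j)) \<and>
    (\<forall>w. viscosity_solution T h F w \<and> (\<forall>i j. poly_growth T (w i j)) \<longrightarrow>
      (\<forall>i j. \<forall>t\<in>{0..T}. \<forall>x. w i j t x = v i j t x))"

subsection \<open>Assumptions on the data\<close>

definition H0 ::
  "real \<Rightarrow> (real \<Rightarrow> real ^ 'k::finite \<Rightarrow> real ^ 'k) \<Rightarrow>
   (real \<Rightarrow> real ^ 'k \<Rightarrow> real ^ 'd::finite ^ 'k) \<Rightarrow> bool" where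
  "H0 T b \<sigma> \<longleftrightarrow>
    jointly_continuous T b \<and> jointly_continuous T \<sigma> \<and>
    (\<exists>C. \<forall>t\<in>{0..T}. C-lipschitz_on UNIV (b t)) \<and>
    (\<exists>C. \<forall>t\<in>{0..T}. C-lipschitz_on UNIV (\<sigma> t))"

definition H1 ::
  "real \<Rightarrow> ('i::finite, 'j::finite, 'k::finite, 'd::finite) driver \<Rightarrow> bool" where
  "H1 T f \<longleftrightarrow> (\<forall>i j.
    (\<forall>t\<in>{0..T}. \<forall>x. \<forall>\<epsilon>>0. \<exists>\<eta>>0. \<forall>t'\<in>{0..T}. \<forall>x'. dist (t', x') (t, x) < \<eta> \<longrightarrow>
      (\<forall>y z. \<bar>f i j t' x' y z - f i j t x y z\<bar> < \<epsilon>)) \<and>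
    poly_growth T (\<lambda>t x. f i j t x 0 0) \<and>
    (\<exists>C. \<forall>t\<in>{0..T}. \<forall>x. C-lipschitz_on UNIV (\<lambda>(y, z). f i j t x y z)))"

definition H2 ::
  "real \<Rightarrow> ('i::finite, 'j::finite, 'k::finite, 'd::finite) driver \<Rightarrow> bool" where
  "H2 T f \<longleftrightarrow> (\<forall>i j m. m \<noteq> (i, j) \<longrightarrow>
    (\<forall>t\<in>{0..T}. \<forall>x y z. mono (\<lambda>r. f i j t x (\<chi> q. if q = m then r else y $ q) z)))"

definition H3 ::
  "real \<Rightarrow> ('i::finite \<Rightarrow> 'j::finite \<Rightarrow> real ^ 'k::finite \<Rightarrow> real) \<Rightarrow>
   ('i \<Rightarrow> 'i \<Rightarrow> real \<Rightarrow> real ^ 'k \<Rightarrow> real) \<Rightarrow>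
   ('j \<Rightarrow> 'j \<Rightarrow> real \<Rightarrow> real ^ 'k \<Rightarrow> real) \<Rightarrow> bool" where
  "H3 T h gl gu \<longleftrightarrow> (\<forall>i j.
    continuous_on UNIV (h i j) \<and> poly_growth T (\<lambda>t. h i j) \<and>
    (\<forall>x. lower_obstacle gl (\<lambda>i j t. h i j) i j T x \<le> ereal (h i j x) \<and>
         ereal (h i j x) \<le> upper_obstacle gu (\<lambda>i j t. h i j) i j T x))"

text \<open>A loop is a list \<open>ms\<close> of modes, indexed from \<open>0\<close>; its length is \<open>N\<close>.\<close>

definition is_loop :: "('i \<times> 'j) list \<Rightarrow> bool" where
  "is_loop ms \<longleftrightarrow>
    length ms \<ge> 3 \<and> last ms = hd ms \<and> card (set ms) = length ms - 1 \<and>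
    (\<forall>q<length ms - 1. fst (ms ! Suc q) = fst (ms ! q) \<or> snd (ms ! Suc q) = snd (ms ! q))"

definition switching_cost ::
  "('i \<Rightarrow> 'i \<Rightarrow> real \<Rightarrow> real ^ 'k \<Rightarrow> real) \<Rightarrow> ('j \<Rightarrow> 'j \<Rightarrow> real \<Rightarrow> real ^ 'k \<Rightarrow> real) \<Rightarrow>
   'i \<times> 'j \<Rightarrow> 'i \<times> 'j \<Rightarrow> real \<Rightarrow> real ^ 'k \<Rightarrow> real" where
  "switching_cost gl gu m m' t x =
    - gl (fst m) (fst m') t x * of_bool (fst m \<noteq> fst m')
    + gu (snd m) (snd m') t x * of_bool (snd m \<noteq> snd m')"

definition H4 ::
  "real \<Rightarrow> ('i::finite \<Rightarrow> 'i \<Rightarrow> real \<Rightarrow> real ^ 'k::finite \<Rightarrow> real) \<Rightarrow>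
   ('j::finite \<Rightarrow> 'j \<Rightarrow> real \<Rightarrow> real ^ 'k \<Rightarrow> real) \<Rightarrow> bool" where
  "H4 T gl gu \<longleftrightarrow>
    (\<forall>i i'. (\<forall>t\<in>{0..T}. \<forall>x. gl i i' t x \<ge> 0) \<and>
      jointly_continuous T (gl i i') \<and> poly_growth T (gl i i')) \<and>
    (\<forall>j l. (\<forall>t\<in>{0..T}. \<forall>x. gu j l t x \<ge> 0) \<and>
      jointly_continuous T (gu j l) \<and> poly_growth T (gu j l)) \<and>
    (\<forall>ms. is_loop ms \<longrightarrow> (\<forall>t\<in>{0..T}. \<forall>x.
      (\<Sum>q<length ms - 1. switching_cost gl gu (ms ! q) (ms ! Suc q) t x) \<noteq> 0))"

definition H5 ::
  "real \<Rightarrow> ('i::finite, 'j::finite, 'k::finite, 'd::finite) driver \<Rightarrow>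
   ('j \<Rightarrow> 'j \<Rightarrow> real \<Rightarrow> real ^ 'k \<Rightarrow> real) \<Rightarrow> bool" where
  "H5 T f gu \<longleftrightarrow>
    (\<forall>j l. \<exists>g\<^sub>t Dg D2g. C12 T (gu j l) g\<^sub>t Dg D2g \<and> poly_growth T Dg \<and> poly_growth T D2g) \<and>
    (\<forall>j\<^sub>1 j\<^sub>2 j\<^sub>3. distinct [j\<^sub>1, j\<^sub>2, j\<^sub>3] \<longrightarrow>
      (\<forall>s\<in>{0..T}. \<forall>x. gu j\<^sub>1 j\<^sub>3 s x < gu j\<^sub>1 j\<^sub>2 s x + gu j\<^sub>2 j\<^sub>3 s x)) \<and>
    (\<exists>C p. 0 \<le> C \<and> 0 \<le> p \<and>
      (\<forall>i j. \<forall>s\<in>{0..T}. \<forall>x y z. \<bar>f i j s x y z\<bar> \<le> C * (1 + norm x powr p)))"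

end

theory Submission
  imports Defs
begin

text \<open>
  If \<open>v\<close> lies between its two obstacles on \<open>[0,T)\<close>, the min-max and the max-min inequalities at a
  test function say the same, so by uniqueness it suffices to show that the min-max solution does.
  Points at which a continuous function can be touched by a test function are dense, so
  \<open>v \<ge> L(v)\<close> everywhere, and \<open>v\<^sup>i\<^sup>j = L\<^sup>i\<^sup>j(v)\<close> wherever \<open>v\<^sup>i\<^sup>j\<close> exceeds \<open>v\<^sup>i\<^sup>l + gu\<^sub>j\<^sub>l\<close>. In the latter case
  \<open>v\<^sup>i\<^sup>j = v\<^sup>i\<^sup>'\<^sup>j - gl\<^sub>i\<^sub>i\<^sub>'\<close> for some \<open>i'\<close>, and \<open>v\<^sup>i\<^sup>l \<ge> v\<^sup>i\<^sup>'\<^sup>l - gl\<^sub>i\<^sub>i\<^sub>'\<close> shows that \<open>v\<^sup>i\<^sup>'\<^sup>j\<close> exceeds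
  \<open>v\<^sup>i\<^sup>'\<^sup>l + gu\<^sub>j\<^sub>l\<close> at the same point. Iterating produces a loop in the first coordinate along which
  the lower costs add up to zero, contrary to (H4).
\<close>

section \<open>Quadratic test functions and touching points\<close>

lemma C12_quadratic:
  fixes y :: "real ^ 'k"
  shows "C12 T (\<lambda>t x. c + n * ((t - s)\<^sup>2 + (norm (x - y))\<^sup>2))
    (\<lambda>t x. 2 * n * (t - s)) (\<lambda>t x. (2 * n) *\<^sub>R (x - y)) (\<lambda>t x. mat (2 * n))"
proof -
  have "((\<lambda>r. c + n * ((r - s)\<^sup>2 + (norm (x - y))\<^sup>2)) has_real_derivative 2 * n * (t - s))
      (at t within {0..T})" for t and x :: "real ^ 'k"
    by (auto intro!: derivative_eq_intros)
  moreover have "GDERIV (\<lambda>x. c + n * ((t - s)\<^sup>2 + (norm (x - y))\<^sup>2)) x :> (2 * n) *\<^sub>R (x - y)"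
    for t and x :: "real ^ 'k"
    unfolding gderiv_def power2_norm_eq_inner
    by (auto intro!: derivative_eq_intros simp: inner_commute algebra_simps)
  moreover have "mat (2 * n) *v w = (2 * n) *\<^sub>R w" for w :: "real ^ 'k"
    by (simp add: vec_eq_iff matrix_vector_mult_def mat_def if_distrib[of "\<lambda>a. a * _"] cong: if_cong)
  then have "((\<lambda>x. (2 * n) *\<^sub>R (x - y)) has_derivative (\<lambda>w. mat (2 * n) *v w)) (at x)"
    for x :: "real ^ 'k"
    by (auto intro!: derivative_eq_intros)
  ultimately show ?thesis
    unfolding C12_def jointly_continuous_def
    by (auto simp: case_prod_unfold intro!: continuous_intros)
qed

text \<open>Maximise \<open>u\<close> minus a steep multiple of the squared distance to
  \<open>(t0, x0)\<close> over a small compact ball. The steepness keeps the maximiser off the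
  sphere, so it is a local maximum relative to the strip.\<close>

lemma ex_touching_from_above:
  fixes u :: "real \<Rightarrow> real ^ 'k \<Rightarrow> real"
  assumes u: "jointly_continuous T u" and t0: "t0 \<in> {0..<T}"
    and W: "openin (top_of_set ({0..T} \<times> UNIV)) W" "(t0, x0) \<in> W"
  shows "\<exists>t1 x1 c n. t1 \<in> {0..<T} \<and> (t1, x1) \<in> W \<and>
    u t1 x1 = c + n * ((t1 - t0)\<^sup>2 + (norm (x1 - x0))\<^sup>2) \<and>
    (\<forall>\<^sub>F (t, x) in at (t1, x1) within {0..T} \<times> UNIV.
      u t x \<le> c + n * ((t - t0)\<^sup>2 + (norm (x - x0))\<^sup>2))"
proof -
  define S where "S = {0..T} \<times> (UNIV :: (real ^ 'k) set)"
  define p0 where "p0 = (t0, x0)"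
  define U where "U = (\<lambda>(t, x). u t x)"
  have contU: "continuous_on S U"
    using u by (simp add: jointly_continuous_def S_def U_def)
  have "p0 \<in> S" using t0 by (auto simp: p0_def S_def)
  obtain e where e: "e > 0" "\<And>p. p \<in> S \<Longrightarrow> dist p p0 < e \<Longrightarrow> p \<in> W"
    using W unfolding openin_euclidean_subtopology_iff p0_def S_def by blast
  \<comment> \<open>Half the minimum keeps the ball inside \<open>W\<close> and all its times
    strictly below \<open>T\<close>, where viscosity inequalities are available.\<close>
  define r where "r = min e (T - t0) / 2"
  have r: "r > 0" "r < e" "r < T - t0"
    using e t0 by (auto simp: r_def min_def)
  define K where "K = cball p0 r \<inter> S"
  have "closed S" by (simp add: S_def closed_Times)
  then have K: "compact K" by (simp add: K_def compact_Int_closed)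
  have p0K: "p0 \<in> K" using r \<open>p0 \<in> S\<close> by (simp add: K_def)
  have contK: "continuous_on K U"
    using contU by (rule continuous_on_subset) (simp add: K_def)
  obtain m where m: "\<And>p. p \<in> K \<Longrightarrow> U p \<le> U m"
    using continuous_attains_sup[OF K _ contK] p0K by blast
  \<comment> \<open>On the sphere the penalty is \<open>U m - U p0 + 1\<close>, so the penalised
    value there is at most \<open>U p0 - 1\<close>, less than at the centre.\<close>
  define n where "n = (U m - U p0 + 1) / r\<^sup>2"
  have nr: "n * r\<^sup>2 = U m - U p0 + 1" using r by (simp add: n_def)
  have "continuous_on K (\<lambda>p. U p - n * (dist p p0)\<^sup>2)"
    by (intro continuous_intros contK)
  then obtain p1 where p1: "p1 \<in> K"
    "\<And>p. p \<in> K \<Longrightarrow> U p - n * (dist p p0)\<^sup>2 \<le> U p1 - n * (dist p1 p0)\<^sup>2"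
    using continuous_attains_sup[OF K] p0K by blast
  have "dist p1 p0 \<noteq> r"
  proof
    assume "dist p1 p0 = r"
    then have "U p0 \<le> U p1 - (U m - U p0 + 1)"
      using p1(2)[OF p0K] nr by simp
    with m[OF p1(1)] show False by simp
  qed
  then have d1: "dist p1 p0 < r"
    using p1(1) by (simp add: K_def dist_commute)
  obtain t1 x1 where p1_eq: "p1 = (t1, x1)" by fastforce
  have "dist t1 t0 \<le> dist p1 p0"
    using dist_fst_le[of p1 p0] by (simp add: p1_eq p0_def)
  then have t1: "t1 \<in> {0..<T}"
    using d1 r p1(1) by (auto simp: K_def S_def p1_eq dist_real_def)
  have inW: "(t1, x1) \<in> W"
    using e(2)[of p1] p1(1) d1 r by (auto simp: K_def p1_eq)
  define c where "c = U p1 - n * (dist p1 p0)\<^sup>2"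
  \<comment> \<open>The product metric is Euclidean, so the penalty is the quadratic of
    \<open>C12_quadratic\<close>.\<close>
  have dist2: "(dist (t, x) p0)\<^sup>2 = (t - t0)\<^sup>2 + (norm (x - x0))\<^sup>2" for t x
    by (simp add: p0_def dist_prod_def dist_norm)
  have "\<forall>\<^sub>F p in at p1 within S. p \<in> ball p0 r \<and> p \<in> S"
    using eventually_at_ball'[of "r - dist p1 p0" p1 S]
    by (smt (verit, ccfv_SIG) d1 dist_commute dist_triangle eventually_mono mem_ball)
  then have "\<forall>\<^sub>F p in at p1 within S. U p \<le> c + n * (dist p p0)\<^sup>2"
    by (rule eventually_mono) (use p1(2) in \<open>force simp: K_def c_def\<close>)
  then have "\<forall>\<^sub>F (t, x) in at (t1, x1) within {0..T} \<times> UNIV.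
      u t x \<le> c + n * ((t - t0)\<^sup>2 + (norm (x - x0))\<^sup>2)"
    unfolding S_def p1_eq
    by (rule eventually_mono) (auto simp: dist2 U_def)
  moreover have "u t1 x1 = c + n * ((t1 - t0)\<^sup>2 + (norm (x1 - x0))\<^sup>2)"
    using dist2[of t1 x1] by (simp add: c_def U_def p1_eq)
  ultimately show ?thesis using t1 inW by blast
qed

section \<open>Viscosity inequalities at a dense set of points\<close>

lemma viscosity_subsolutionD:
  assumes "viscosity_subsolution T h F v" "t0 \<in> {0..<T}"
    and "C12 T \<phi> \<phi>t D\<phi> D2\<phi>" "\<phi> t0 x0 = v i j t0 x0"
    and "\<forall>\<^sub>F (t, x) in at (t0, x0) within {0..T} \<times> UNIV.
      \<phi> t0 x0 - v i j t0 x0 \<le> \<phi> t x - v i j t x"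
  shows "F v i j t0 x0 (\<phi>t t0 x0) (D\<phi> t0 x0) (D2\<phi> t0 x0) \<le> 0"
  using assms(1)[unfolded viscosity_subsolution_def, THEN conjunct2, THEN spec[of _ i],
      THEN spec[of _ j], THEN conjunct2, THEN bspec, OF assms(2), THEN spec[of _ x0],
      THEN spec[of _ \<phi>], THEN spec[of _ \<phi>t], THEN spec[of _ D\<phi>], THEN spec[of _ D2\<phi>]]
    assms(3-5)
  by (elim mp) (intro conjI)

lemma viscosity_supersolutionD:
  assumes "viscosity_supersolution T h F v" "t0 \<in> {0..<T}"
    and "C12 T \<phi> \<phi>t D\<phi> D2\<phi>" "\<phi> t0 x0 = v i j t0 x0"
    and "\<forall>\<^sub>F (t, x) in at (t0, x0) within {0..T} \<times> UNIV.
      \<phi> t0 x0 - v i j t0 x0 \<ge> \<phi> t x - v i j t x"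
  shows "F v i j t0 x0 (\<phi>t t0 x0) (D\<phi> t0 x0) (D2\<phi> t0 x0) \<ge> 0"
  using assms(1)[unfolded viscosity_supersolution_def, THEN conjunct2, THEN spec[of _ i],
      THEN spec[of _ j], THEN conjunct2, THEN bspec, OF assms(2), THEN spec[of _ x0],
      THEN spec[of _ \<phi>], THEN spec[of _ \<phi>t], THEN spec[of _ D\<phi>], THEN spec[of _ D2\<phi>]]
    assms(3-5)
  by (elim mp) (intro conjI)

text \<open>The touching quadratic is an admissible test function. Its derivatives are left
  unspecified in the conclusion because the obstacle terms do not depend on them.\<close>

lemma viscosity_subsolution_dense:
  assumes v: "viscosity_subsolution T h F v" and t0: "t0 \<in> {0..<T}"
    and W: "openin (top_of_set ({0..T} \<times> UNIV)) W" "(t0, x0) \<in> W"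
  obtains t x a p X where "t \<in> {0..<T}" "(t, x) \<in> W" "F v i j t x a p X \<le> 0"
proof -
  have "jointly_continuous T (v i j)"
    using v by (simp add: viscosity_subsolution_def)
  from ex_touching_from_above[OF this t0 W] obtain t1 x1 c n where
    *: "t1 \<in> {0..<T}" "(t1, x1) \<in> W" "v i j t1 x1 = c + n * ((t1 - t0)\<^sup>2 + (norm (x1 - x0))\<^sup>2)"
      "\<forall>\<^sub>F (t, x) in at (t1, x1) within {0..T} \<times> UNIV.
        v i j t x \<le> c + n * ((t - t0)\<^sup>2 + (norm (x - x0))\<^sup>2)"
    by blast
  let ?\<phi> = "\<lambda>t x. c + n * ((t - t0)\<^sup>2 + (norm (x - x0))\<^sup>2)"
  have "\<forall>\<^sub>F (t, x) in at (t1, x1) within {0..T} \<times> UNIV.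
      ?\<phi> t1 x1 - v i j t1 x1 \<le> ?\<phi> t x - v i j t x"
    using *(4) by (rule eventually_mono) (auto simp: *(3))
  then have "F v i j t1 x1 (2 * n * (t1 - t0)) ((2 * n) *\<^sub>R (x1 - x0)) (mat (2 * n)) \<le> 0"
    by (rule viscosity_subsolutionD[OF v *(1) C12_quadratic *(3)[symmetric]])
  with *(1,2) show thesis by (rule that)
qed

lemma viscosity_supersolution_dense:
  assumes v: "viscosity_supersolution T h F v" and t0: "t0 \<in> {0..<T}"
    and W: "openin (top_of_set ({0..T} \<times> UNIV)) W" "(t0, x0) \<in> W"
  obtains t x a p X where "t \<in> {0..<T}" "(t, x) \<in> W" "F v i j t x a p X \<ge> 0"
proof -
  have "jointly_continuous T (v i j)"
    using v by (simp add: viscosity_supersolution_def)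
  then have "jointly_continuous T (\<lambda>t x. - v i j t x)"
    unfolding jointly_continuous_def by (auto simp: case_prod_unfold intro!: continuous_intros)
  from ex_touching_from_above[OF this t0 W] obtain t1 x1 c n where
    *: "t1 \<in> {0..<T}" "(t1, x1) \<in> W" "- v i j t1 x1 = c + n * ((t1 - t0)\<^sup>2 + (norm (x1 - x0))\<^sup>2)"
      "\<forall>\<^sub>F (t, x) in at (t1, x1) within {0..T} \<times> UNIV.
        - v i j t x \<le> c + n * ((t - t0)\<^sup>2 + (norm (x - x0))\<^sup>2)"
    by blast
  \<comment> \<open>Touching \<open>- v i j\<close> from above is touching \<open>v i j\<close> from
    below by the negated quadratic, written so that it is again an instance of
    \<open>C12_quadratic\<close>.\<close>
  let ?\<phi> = "\<lambda>t x. - c + - n * ((t - t0)\<^sup>2 + (norm (x - x0))\<^sup>2)"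
  have eq: "?\<phi> t1 x1 = v i j t1 x1"
    using *(3) by simp
  have "\<forall>\<^sub>F (t, x) in at (t1, x1) within {0..T} \<times> UNIV.
      ?\<phi> t1 x1 - v i j t1 x1 \<ge> ?\<phi> t x - v i j t x"
    using *(4) by (rule eventually_mono) (unfold eq, auto)
  then have "F v i j t1 x1 (2 * - n * (t1 - t0)) ((2 * - n) *\<^sub>R (x1 - x0)) (mat (2 * - n)) \<ge> 0"
    by (rule viscosity_supersolutionD[OF v *(1) C12_quadratic eq])
  with *(1,2) show thesis by (rule that)
qed

section \<open>Obstacle inequalities for the min-max system\<close>

lemma openin_less_jointly_continuous:
  fixes u w :: "real \<Rightarrow> real ^ 'k \<Rightarrow> real"
  assumes "jointly_continuous T u" "jointly_continuous T w"
  shows "openin (top_of_set ({0..T} \<times> UNIV)) {(t, x). t \<in> {0..T} \<and> u t x < w t x}"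
proof -
  let ?d = "\<lambda>(t, x). w t x - u t x" and ?S = "{0..T} \<times> (UNIV :: (real ^ 'k) set)"
  have "continuous_on ?S ?d"
    using assms unfolding jointly_continuous_def
    by (auto simp: case_prod_unfold intro!: continuous_intros)
  then have "openin (top_of_set ?S) (?S \<inter> ?d -` {0<..})"
    by (intro continuous_openin_preimage_gen) auto
  also have "?S \<inter> ?d -` {0<..} = {(t, x). t \<in> {0..T} \<and> u t x < w t x}"
    by auto
  finally show ?thesis .
qed

lemma jointly_continuous_add:
  fixes u w :: "real \<Rightarrow> real ^ 'k \<Rightarrow> real"
  shows "jointly_continuous T u \<Longrightarrow> jointly_continuous T w \<Longrightarrow>
    jointly_continuous T (\<lambda>t x. u t x + w t x)"
  unfolding jointly_continuous_def by (auto simp: case_prod_unfold intro!: continuous_intros)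

lemma jointly_continuous_diff:
  fixes u w :: "real \<Rightarrow> real ^ 'k \<Rightarrow> real"
  shows "jointly_continuous T u \<Longrightarrow> jointly_continuous T w \<Longrightarrow>
    jointly_continuous T (\<lambda>t x. u t x - w t x)"
  unfolding jointly_continuous_def by (auto simp: case_prod_unfold intro!: continuous_intros)

lemma lower_obstacle_le_iff:
  "0 \<le> ereal r - lower_obstacle gl v i j t x \<longleftrightarrow>
    (\<forall>i'. i' \<noteq> i \<longrightarrow> v i' j t x - gl i i' t x \<le> r)"
proof -
  have "0 \<le> ereal r - L \<longleftrightarrow> L \<le> ereal r" for L
    by (cases L) auto
  then show ?thesis by (simp add: lower_obstacle_def SUP_le_iff)
qed

lemma le_upper_obstacle_iff:
  "ereal r - upper_obstacle gu v i j t x \<le> 0 \<longleftrightarrow>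
    (\<forall>l. l \<noteq> j \<longrightarrow> r \<le> v i l t x + gu j l t x)"
proof -
  have "ereal r - U \<le> 0 \<longleftrightarrow> ereal r \<le> U" for U
    by (cases U) auto
  then show ?thesis by (simp add: upper_obstacle_def le_INF_iff)
qed

text \<open>A supremum over a finite nonempty set is attained. With a single mode the obstacle is
  minus infinity and both sides are false.\<close>

lemma le_lower_obstacle_iff:
  fixes gl :: "'i::finite \<Rightarrow> 'i \<Rightarrow> real \<Rightarrow> real ^ 'k \<Rightarrow> real"
  shows "ereal r - lower_obstacle gl v i j t x \<le> 0 \<longleftrightarrow>
    (\<exists>i'. i' \<noteq> i \<and> r \<le> v i' j t x - gl i i' t x)"
proof (cases "{i'. i' \<noteq> i} = {}")
  case True
  then have "lower_obstacle gl v i j t x = -\<infinity>"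
    by (simp only: lower_obstacle_def image_empty Sup_empty bot_ereal_def)
  moreover have "\<not> (\<exists>i'. i' \<noteq> i \<and> r \<le> v i' j t x - gl i i' t x)"
    using True by blast
  ultimately show ?thesis by simp
next
  case False
  have "ereal r - L \<le> 0 \<longleftrightarrow> \<not> L < ereal r" for L
    by (cases L) auto
  then have "ereal r - lower_obstacle gl v i j t x \<le> 0 \<longleftrightarrow>
      \<not> (\<forall>e\<in>(\<lambda>i'. ereal (v i' j t x - gl i i' t x)) ` {i'. i' \<noteq> i}. e < ereal r)"
    unfolding lower_obstacle_def using False
    by (simp only: finite_Sup_less_iff finite_imageI finite image_is_empty not_False_eq_True)
  also have "\<dots> \<longleftrightarrow> (\<exists>i'. i' \<noteq> i \<and> r \<le> v i' j t x - gl i i' t x)"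
    by (simp add: not_less)
  finally show ?thesis .
qed

text \<open>By continuity a violation persists on a relatively open set, which contains a point
  where the outer minimum is non-negative; its first entry then contradicts the violation.\<close>

lemma min_max_supersolution_ge_lower:
  assumes v: "viscosity_supersolution T h (min_max_system b \<sigma> f gl gu) v"
    and gl: "\<And>i i'. jointly_continuous T (gl i i')"
    and t: "t \<in> {0..<T}" and "i' \<noteq> i"
  shows "v i' j t x - gl i i' t x \<le> v i j t x"
proof (rule ccontr)
  assume less: "\<not> ?thesis"
  let ?W = "{(t, x). t \<in> {0..T} \<and> v i j t x < v i' j t x - gl i i' t x}"
  have cont: "jointly_continuous T (v i j)" for i j
    using v by (simp add: viscosity_supersolution_def)
  have W: "openin (top_of_set ({0..T} \<times> UNIV)) ?W"
    using cont gl by (intro openin_less_jointly_continuous jointly_continuous_diff)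
  have inW: "(t, x) \<in> ?W" using less t by auto
  obtain t' x' a p X where t': "(t', x') \<in> ?W"
      "0 \<le> min_max_system b \<sigma> f gl gu v i j t' x' a p X"
    by (rule viscosity_supersolution_dense[OF v t W inW, of i j])
  from t'(2) have "0 \<le> ereal (v i j t' x') - lower_obstacle gl v i j t' x'"
    by (simp add: min_max_system_def)
  with t'(1) \<open>i' \<noteq> i\<close> show False
    unfolding lower_obstacle_le_iff by force
qed

text \<open>If \<open>v i j\<close> exceeded every lower competitor as well as the upper one for
  \<open>l\<close>, it would do so on a relatively open set. There both obstacle differences are
  positive, making the min-max expression positive whatever the PDE term is.\<close>

lemma min_max_subsolution_le_lower:
  assumes v: "viscosity_subsolution T h (min_max_system b \<sigma> f gl gu) v"
    and gl: "\<And>i i'. jointly_continuous T (gl i i')"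
    and gu: "\<And>j l. jointly_continuous T (gu j l)"
    and t: "t \<in> {0..<T}" and "l \<noteq> j" and less_v: "v i l t x + gu j l t x < v i j t x"
  shows "\<exists>i'. i' \<noteq> i \<and> v i j t x \<le> v i' j t x - gl i i' t x"
proof (rule ccontr)
  assume less: "\<not> ?thesis"
  let ?V = "{(t, x). t \<in> {0..T} \<and> v i l t x + gu j l t x < v i j t x}"
  let ?W = "\<lambda>i'. {(t, x). t \<in> {0..T} \<and> v i' j t x - gl i i' t x < v i j t x}"
  let ?U = "?V \<inter> (\<Inter>i'\<in>-{i}. ?W i')"
  have cont: "jointly_continuous T (v i j)" for i j
    using v by (simp add: viscosity_subsolution_def)
  have V: "openin (top_of_set ({0..T} \<times> UNIV)) ?V"
    using cont gu by (intro openin_less_jointly_continuous jointly_continuous_add)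
  have W: "openin (top_of_set ({0..T} \<times> UNIV)) (?W i')" for i'
    using cont gl by (intro openin_less_jointly_continuous jointly_continuous_diff)
  \<comment> \<open>With a single first mode the intersection runs over the empty family and
    \<open>?U\<close> is just \<open>?V\<close>.\<close>
  have U: "openin (top_of_set ({0..T} \<times> UNIV)) ?U"
  proof (cases "-{i} = {}")
    case True
    with V show ?thesis by (simp only: INF_empty Int_UNIV_right)
  next
    case False
    with V W show ?thesis by (intro openin_Int openin_INT2) auto
  qed
  have inU: "(t, x) \<in> ?U" using less less_v t by auto
  obtain t' x' a p X where t': "(t', x') \<in> ?U"
      "min_max_system b \<sigma> f gl gu v i j t' x' a p X \<le> 0"
    by (rule viscosity_subsolution_dense[OF v t U inU, of i j])
  have "v i' j t' x' - gl i i' t' x' < v i j t' x'" if "i' \<noteq> i" for i'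
    using t'(1) that by auto
  then have "\<not> ereal (v i j t' x') - lower_obstacle gl v i j t' x' \<le> 0"
    unfolding le_lower_obstacle_iff by (meson not_less)
  moreover have "v i l t' x' + gu j l t' x' < v i j t' x'"
    using t'(1) by simp
  then have "\<not> ereal (v i j t' x') - upper_obstacle gu v i j t' x' \<le> 0"
    using \<open>l \<noteq> j\<close> unfolding le_upper_obstacle_iff by (meson not_less)
  ultimately show False
    using t'(2) by (simp add: min_max_system_def min_le_iff_disj)
qed

section \<open>Cycles of modes and the non free loop property\<close>

lemma ex_cycle_finite:
  fixes s :: "'a::finite \<Rightarrow> 'a"
  obtains k m where "m > 0" "inj_on (\<lambda>q. (s ^^ q) a) {k..<k + m}" "(s ^^ (k + m)) a = (s ^^ k) a"
proof -
  let ?P = "\<lambda>n. \<exists>k<n. (s ^^ k) a = (s ^^ n) a"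
  have "\<not> inj (\<lambda>q. (s ^^ q) a)"
    using finite_imageD[OF finite, of "\<lambda>q. (s ^^ q) a" UNIV] by auto
  then obtain p q where "p \<noteq> q" "(s ^^ p) a = (s ^^ q) a" by (auto simp: inj_def)
  then have "\<exists>n. ?P n" by (metis nat_neq_iff)
  \<comment> \<open>At the first index that repeats an earlier value, all previous iterates are
    still distinct.\<close>
  define n where "n = (LEAST n. ?P n)"
  have n: "\<not> ?P n'" if "n' < n" for n'
    using that unfolding n_def by (rule not_less_Least)
  have "?P n"
    unfolding n_def by (rule LeastI_ex) fact
  then obtain k where k: "k < n" "(s ^^ k) a = (s ^^ n) a" by blast
  have "inj_on (\<lambda>q. (s ^^ q) a) {..<n}"
    using n by (intro linorder_inj_onI) auto
  then have "inj_on (\<lambda>q. (s ^^ q) a) {k..<k + (n - k)}"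
    using k by (auto intro: inj_on_subset)
  then show thesis
    using k by (intro that[of "n - k" k]) auto
qed

text \<open>Iterating \<open>s\<close> inside the finite set \<open>B\<close> must close a cycle.
  The lower costs along it are increments of the potential \<open>u\<close>, so they telescope to
  zero around the cycle.\<close>

lemma H4_no_free_cycle:
  fixes gl :: "'i::finite \<Rightarrow> 'i \<Rightarrow> real \<Rightarrow> real ^ 'k \<Rightarrow> real"
    and gu :: "'j::finite \<Rightarrow> 'j \<Rightarrow> real \<Rightarrow> real ^ 'k \<Rightarrow> real"
  assumes H4: "H4 T gl gu" and t: "t \<in> {0..T}"
    and s: "\<And>i. i \<in> B \<Longrightarrow> s i \<in> B \<and> s i \<noteq> i \<and> u i + gl i (s i) t x = u (s i)"
  shows "B = {}"
proof (rule ccontr)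
  assume "B \<noteq> {}"
  then obtain i0 where "i0 \<in> B" by blast
  define a where "a q = (s ^^ q) i0" for q
  have aB: "a q \<in> B" for q
    by (induction q) (use s \<open>i0 \<in> B\<close> in \<open>auto simp: a_def\<close>)
  have a_Suc: "a (Suc q) = s (a q)" for q by (simp add: a_def)
  obtain k m where m: "m > 0" "inj_on a {k..<k + m}" "a (k + m) = a k"
    using ex_cycle_finite[of s i0] unfolding a_def by blast
  \<comment> \<open>As \<open>s\<close> has no fixed point on \<open>B\<close>, the period is at
    least 2 and the closed list has at least 3 entries.\<close>
  have "m \<noteq> 1"
    using m(3) s[OF aB[of k]] a_Suc[of k] by auto
  \<comment> \<open>Freezing the second mode makes all upper costs vanish from the loop sum.\<close>
  fix j :: 'j
  \<comment> \<open>The end index \<open>k + m\<close> is included, so the starting mode is listed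
    twice: \<open>m + 1\<close> entries, \<open>m\<close> distinct modes.\<close>
  define ms where "ms = map (\<lambda>q. (a q, j)) [k..<Suc (k + m)]"
  have nth: "ms ! q = (a (k + q), j)" if "q \<le> m" for q
    using that by (simp add: ms_def del: upt_Suc)
  have len: "length ms = Suc m" by (simp add: ms_def)
  have "set ms = (\<lambda>q. (a q, j)) ` {k..k + m}"
    by (simp add: ms_def atLeastLessThanSuc_atLeastAtMost del: upt_Suc)
  also have "\<dots> = (\<lambda>q. (a q, j)) ` {k..<k + m}"
    using m(1,3) by (force simp: image_iff le_less)
  also have "card \<dots> = m"
    using m(2) by (subst card_image) (auto simp: inj_on_def)
  finally have "card (set ms) = m" .
  moreover have "last ms = hd ms"
    using m(3) nth[of 0] nth[of m] len by (simp add: last_conv_nth hd_conv_nth flip: length_0_conv)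
  ultimately have loop: "is_loop ms"
    using m(1) \<open>m \<noteq> 1\<close> by (auto simp: is_loop_def len nth)
  have zero: "(\<Sum>q<m. switching_cost gl gu (ms ! q) (ms ! Suc q) t x) = 0"
  proof -
    have "switching_cost gl gu (ms ! q) (ms ! Suc q) t x = u (a (k + q)) - u (a (k + Suc q))"
      if "q < m" for q
      using s[OF aB[of "k + q"]] that by (simp add: switching_cost_def nth a_Suc)
    then have "(\<Sum>q<m. switching_cost gl gu (ms ! q) (ms ! Suc q) t x) =
        (\<Sum>q<m. u (a (k + q)) - u (a (k + Suc q)))"
      by simp
    also have "\<dots> = 0"
      using sum_lessThan_telescope'[of "\<lambda>q. u (a (k + q))" m] m(3) by simp
    finally show ?thesis .
  qed
  have "(\<Sum>q<length ms - 1. switching_cost gl gu (ms ! q) (ms ! Suc q) t x) \<noteq> 0"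
    using H4[unfolded H4_def, THEN conjunct2, THEN conjunct2] loop t by (elim allE impE ballE) auto
  with zero len show False by simp
qed

section \<open>From the min-max to the max-min system\<close>

lemma min_max_solution_le_upper:
  assumes v: "viscosity_solution T h (min_max_system b \<sigma> f gl gu) v"
    and H4: "H4 T gl gu" and t: "t \<in> {0..<T}" and "l \<noteq> j"
  shows "v i j t x \<le> v i l t x + gu j l t x"
proof -
  have gl: "jointly_continuous T (gl i i')" and gu: "jointly_continuous T (gu j l)" for i i' j l
    using H4 by (auto simp: H4_def)
  have lower: "v i' j t x - gl i i' t x \<le> v i j t x" if "i' \<noteq> i" for i i' j
    using v gl t that unfolding viscosity_solution_def
    by (intro min_max_supersolution_ge_lower[where T = T]) auto
  \<comment> \<open>The point and the pair \<open>j\<close>, \<open>l\<close> stay fixed; only the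
    first mode varies, with potential \<open>v i j t x\<close>.\<close>
  define B where "B = {i. v i l t x + gu j l t x < v i j t x}"
  have "\<exists>i'. i' \<in> B \<and> i' \<noteq> i \<and> v i j t x + gl i i' t x = v i' j t x" if i: "i \<in> B" for i
  proof -
    obtain i' where i': "i' \<noteq> i" "v i j t x \<le> v i' j t x - gl i i' t x"
      using v gl gu t \<open>l \<noteq> j\<close> i min_max_subsolution_le_lower[of T h b \<sigma> f gl gu v t l j i x]
      unfolding viscosity_solution_def B_def by blast
    then have "v i j t x + gl i i' t x = v i' j t x"
      using lower[OF i'(1), of j] by linarith
    \<comment> \<open>The violation is inherited: \<open>v i' j = v i j + gl i i' > v i l + gu j l +
      gl i i' >= v i' l + gu j l\<close> at \<open>(t, x)\<close>.\<close>
    moreover from this have "i' \<in> B"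
      using lower[OF i'(1), of l] i unfolding B_def mem_Collect_eq by linarith
    ultimately show ?thesis using i'(1) by blast
  qed
  then obtain s where
    "\<And>i. i \<in> B \<Longrightarrow> s i \<in> B \<and> s i \<noteq> i \<and> v i j t x + gl i (s i) t x = v (s i) j t x"
    by metis
  then have "B = {}"
    using H4_no_free_cycle[OF H4, of t B s "\<lambda>i. v i j t x" x] t by auto
  then show ?thesis by (auto simp: B_def not_less)
qed

lemma min_max_solution_imp_max_min_solution:
  assumes v: "viscosity_solution T h (min_max_system b \<sigma> f gl gu) v" and H4: "H4 T gl gu"
  shows "viscosity_solution T h (max_min_system b \<sigma> f gl gu) v"
proof -
  have "jointly_continuous T (gl i i')" for i i'
    using H4 by (simp add: H4_def)
  then have lower: "0 \<le> ereal (v i j t x) - lower_obstacle gl v i j t x"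
    if "t \<in> {0..<T}" for i j t x
    unfolding lower_obstacle_le_iff
    using min_max_supersolution_ge_lower[OF conjunct2[OF v[unfolded viscosity_solution_def]]] that
    by simp
  have upper: "ereal (v i j t x) - upper_obstacle gu v i j t x \<le> 0" if "t \<in> {0..<T}" for i j t x
    using min_max_solution_le_upper[OF v H4 that] unfolding le_upper_obstacle_iff by blast
  \<comment> \<open>Given these signs, either expression is \<open><= 0\<close> iff the lower
    difference or the PDE term is, and \<open>>= 0\<close> iff the upper difference or the PDE term
    is.\<close>
  have iff: "min_max_system b \<sigma> f gl gu v i j t x a p X \<le> 0 \<longleftrightarrow>
      max_min_system b \<sigma> f gl gu v i j t x a p X \<le> 0"
    "0 \<le> min_max_system b \<sigma> f gl gu v i j t x a p X \<longleftrightarrow>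
      0 \<le> max_min_system b \<sigma> f gl gu v i j t x a p X"
    if "t \<in> {0..<T}" for i j t x a p X
    using lower[OF that] upper[OF that]
    by (auto simp: min_max_system_def max_min_system_def min_le_iff_disj le_max_iff_disj)
  \<comment> \<open>The system is evaluated only at times in \<open>{0..<T}\<close>, where
    \<open>iff\<close> applies; continuity and the terminal conditions do not mention it.\<close>
  have "viscosity_solution T h (min_max_system b \<sigma> f gl gu) v \<longleftrightarrow>
      viscosity_solution T h (max_min_system b \<sigma> f gl gu) v"
    unfolding viscosity_solution_def viscosity_subsolution_def viscosity_supersolution_def
    by (simp only: iff cong: ball_cong)
  from this v show ?thesis by (rule iffD1)
qed

theorem theorem3p2:
  fixes T :: real
    and b :: "real \<Rightarrow> real ^ 'k \<Rightarrow> real ^ 'k"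
    and \<sigma> :: "real \<Rightarrow> real ^ 'k \<Rightarrow> real ^ 'd ^ 'k"
    and f :: "'i::finite \<Rightarrow> 'j::finite \<Rightarrow> real \<Rightarrow> real ^ 'k \<Rightarrow> real ^ ('i \<times> 'j) \<Rightarrow> real ^ 'd \<Rightarrow> real"
    and h :: "'i \<Rightarrow> 'j \<Rightarrow> real ^ 'k \<Rightarrow> real"
    and gl :: "'i \<Rightarrow> 'i \<Rightarrow> real \<Rightarrow> real ^ 'k \<Rightarrow> real"
    and gu :: "'j \<Rightarrow> 'j \<Rightarrow> real \<Rightarrow> real ^ 'k \<Rightarrow> real"
    and v_bar v_under :: "'i \<Rightarrow> 'j \<Rightarrow> real \<Rightarrow> real ^ 'k \<Rightarrow> real"
  assumes "T > 0"
    and "\<forall>i. \<forall>t\<in>{0..T}. \<forall>x. gl i i t x = 0"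
    and "\<forall>j. \<forall>t\<in>{0..T}. \<forall>x. gu j j t x = 0"
    and "H0 T b \<sigma>"
    and "H1 T f"
    and "H2 T f"
    and "H3 T h gl gu"
    and "H4 T gl gu"
    and "H5 T f gu"
    and "unique_viscosity_solution T h (min_max_system b \<sigma> f gl gu) v_bar"
    and "unique_viscosity_solution T h (max_min_system b \<sigma> f gl gu) v_under"
  shows "\<forall>i j. \<forall>t\<in>{0..T}. \<forall>x. v_bar i j t x = v_under i j t x"
proof -
  have "viscosity_solution T h (max_min_system b \<sigma> f gl gu) v_bar"
    using assms(8,10) unfolding unique_viscosity_solution_def
    by (intro min_max_solution_imp_max_min_solution) blast+
  \<comment> \<open>\<open>v_bar\<close> has polynomial growth, so uniqueness for the max-min system
    identifies it with \<open>v_under\<close>.\<close>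
  then show ?thesis
    using assms(10,11) unfolding unique_viscosity_solution_def by blast
qed

end
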